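(* Let $n\ge 1$ be an integer and let $l\in[0,2n]$. The reduction map $$\mathrm{red}_l:\ SST_{2n}(\varpi_l)\longrightarrow \bigsqcup_{\substack{0\le t\le \min\{l,2n-l\}\\ l-t\in 2\mathbb Z}} SpT_{2n}(\varpi_t),\qquad \mathbf a\mapsto \mathrm{red}(\mathbf a)=\mathbf a\setminus \mathrm{rem}(\mathbf a),$$ is surjective, and therefore (as it is known to be injective) the inverse map $\mathrm{red}_l^{-1}$ exists.
   Context: For integers $a,b$, $[a,b]=\{x\in\mathbb Z: a\le x\le b\}$. For $k\in[0,2n]$, $\varpi_k=(1,\dots,1)$ ($k$ ones), and $SST_{2n}(\varpi_k)$ is the set of columns of length $k$ on the alphabet $[1,2n]$, i.e. strictly increasing sequences $(a_1<\dots<a_k)$ with entries in $[1,2n]$ (also regarded as $k$-element subsets of $[1,2n]$; for $k=0$ the only column is the empty column $()$). A column $(a_1,\dots,a_k)$ is symplectic if $a_i\ge 2i-1$ for all $i\in[1,k]$; $SpT_{2n}(\varpi_k)\subseteq SST_{2n}(\varpi_k)$ is the set of symplectic columns of length $k$. For a column $\mathbf a=(a_1,\dots,a_l)$ the set of removal entries $\mathrm{rem}(\mathbf a)\subseteq\mathbf a$ is defined recursively: - $\mathrm{rem}(\mathbf a)=\emptyset$ if $l\le 1$; - $\mathrm{rem}(\mathbf a)=\mathrm{rem}(a_1,\dots,a_{l-2})\sqcup\{a_{l-1},a_l\}$ if $l\ge2$, $a_l$ is even, $a_{l-1}=a_l-1$ and $a_l<2l-|\mathrm{rem}(a_1,\dots,a_{l-2})|-1$;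 - $\mathrm{rem}(\mathbf a)=\mathrm{rem}(a_1,\dots,a_{l-1})$ otherwise. The reduction of $\mathbf a$ is $\mathrm{red}(\mathbf a)=\mathbf a\setminus\mathrm{rem}(\mathbf a)$. It is known (Watanabe) that $\mathrm{red}(\mathbf a)$ is a symplectic column whose length $t$ satisfies $0\le t\le\min\{l,2n-l\}$ and $l-t\in2\mathbb Z$, and that $\mathrm{red}_l$ is injective. *)

theory Defs
  imports Main
begin

text \<open>
  A column is the list of its entries, read from top to bottom. List positions start at 0, so the
  entry \<open>a\<^sub>i\<close> is \<open>a ! (i - 1)\<close>.
\<close>

definition columns :: "nat \<Rightarrow> nat \<Rightarrow> int list set" where
  "columns n k = {a. length a = k \<and> sorted_wrt (<) a \<and> set a \<subseteq> {1..2 * int n}}"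

definition symplectic :: "int list \<Rightarrow> bool" where
  "symplectic a \<longleftrightarrow> (\<forall>i\<in>{1..length a}. a ! (i - 1) \<ge> 2 * int i - 1)"

definition symplectic_columns :: "nat \<Rightarrow> nat \<Rightarrow> int list set" where
  "symplectic_columns n k = {a \<in> columns n k. symplectic a}"

function removal_entries :: "int list \<Rightarrow> int set" where
  "removal_entries a =
     (let l = length a in
      if l \<le> 1 then {}
      else
        let R = removal_entries (take (l - 2) a) in
        if even (a ! (l - 1)) \<and> a ! (l - 2) = a ! (l - 1) - 1 \<and>
           a ! (l - 1) < 2 * int l - int (card R) - 1
        then R \<union> {a ! (l - 2), a ! (l - 1)}
        else removal_entries (take (l - 1) a))"
  by pat_completeness auto
termination
  by (relation "measure length") auto

text \<open>The unconditional defining equation makes the simplifier loop.\<close>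
declare removal_entries.simps [simp del]

definition reduction :: "int list \<Rightarrow> int list" where
  "reduction a = filter (\<lambda>x. x \<notin> removal_entries a) a"

text \<open>Columns of different lengths are different lists, so the union is disjoint.\<close>
definition reduced_columns :: "nat \<Rightarrow> nat \<Rightarrow> int list set" where
  "reduced_columns n l =
     (\<Union>t\<in>{t. t \<le> min l (2 * n - l) \<and> even (l - t)}. symplectic_columns n t)"

end

theory Submission
  imports Defs
begin

text \<open>
  Cut the alphabet into the consecutive pairs \<open>{2k - 1, 2k}\<close>, and read a column \<open>a\<close> pair by pair.
  After \<open>k\<close> pairs, let \<open>b\<close> be the reduction of the part read so far and \<open>p\<close> the number of removed
  pairs, so that this part has length \<open>length b + 2 p\<close>. If the next pair lies completely in \<open>a\<close>, the
  numerical condition in the definition of the removal entries says \<open>k \<le> length b + p\<close>. By induction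
  \<open>length b + p \<le> k\<close>, so a full pair is removed exactly when equality holds. In other words, the slack
  \<open>k - length b - p\<close> performs a walk that goes up at an absent pair, stays at a pair of which one
  entry is present, goes down at a full pair, and stays at 0 instead of becoming negative; the
  full pairs removed are those at which it is held back at 0.

  The bound on the slack shows that the reduction is symplectic and gives the bound on its length.
  Conversely, \<open>(b, p)\<close> determines the walk from its end. The only ambiguity is at a pair absent from
  \<open>b\<close>, which was either absent from \<open>a\<close> or removed, and the final slack tells these cases apart: if
  the pair was removed then \<open>length b + p = k + 1\<close> afterwards, if it was absent then
  \<open>length b + p \<le> k\<close>. So every symplectic \<open>b\<close> and every \<open>p \<le> n - length b\<close> come from exactly one
  column. Since \<open>p\<close> is determined by the lengths of \<open>a\<close> and \<open>b\<close>, this is the claimed bijection.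

  The relation \<open>reduces\<close> is the graph of the walk. The lemma \<open>reduces_sound\<close> identifies it with
  the given reduction, \<open>reduces_total\<close> and \<open>reduces_surj\<close> say that every column and every pair
  \<open>(b, p)\<close> as above occur, and \<open>reduces_inj\<close> is the uniqueness.
\<close>

section \<open>Columns and pairs of letters\<close>

abbreviation column :: "nat \<Rightarrow> int list \<Rightarrow> bool" where
  "column n a \<equiv> a \<in> columns n (length a)"

lemma column_Nil: "[] \<in> columns n 0"
  by (simp add: columns_def)

lemma column_0: "column 0 a \<Longrightarrow> a = []"
  by (simp add: columns_def)

lemma column_Suc: "a \<in> columns n k \<Longrightarrow> a \<in> columns (Suc n) k"
  by (auto simp: columns_def)

lemma column_snoc:
  assumes "a \<in> columns n k" and "x = 2 * int n + 1 \<or> x = 2 * int n + 2"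
  shows "a @ [x] \<in> columns (Suc n) (Suc k)"
  using assms by (fastforce simp: columns_def sorted_wrt_append)

lemma column_snoc_pair:
  assumes "a \<in> columns n k"
  shows "a @ [2 * int n + 1, 2 * int n + 2] \<in> columns (Suc n) (Suc (Suc k))"
  using assms by (fastforce simp: columns_def sorted_wrt_append)

lemma column_bound: "column n a \<Longrightarrow> x \<in> set a \<Longrightarrow> x \<le> 2 * int n"
  by (auto simp: columns_def)

lemma column_Suc_cases:
  assumes "column (Suc n) a"
  obtains (absent) "column n a"
  | (single) b x where "column n b" "x = 2 * int n + 1 \<or> x = 2 * int n + 2" "a = b @ [x]"
  | (both) b where "column n b" "a = b @ [2 * int n + 1, 2 * int n + 2]"
proof (cases a rule: rev_cases)
  case Nil
  then show ?thesis using absent column_Nil by simp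
next
  case a: (snoc b y)
  have sb: "sorted_wrt (<) b" "\<And>z. z \<in> set b \<Longrightarrow> 1 \<le> z \<and> z < y" and y: "1 \<le> y" "y \<le> 2 * int n + 2"
    using assms a by (auto simp: columns_def sorted_wrt_append)
  consider "y \<le> 2 * int n" | "y = 2 * int n + 1" | "y = 2 * int n + 2" using y by linarith
  then show ?thesis
  proof cases
    case 1
    have "column n a" using a sb y 1 by (fastforce simp: columns_def sorted_wrt_append)
    then show ?thesis by (rule absent)
  next
    case 2
    have "column n b" using sb 2 by (fastforce simp: columns_def)
    then show ?thesis using single 2 a by blast
  next
    case 3
    show ?thesis
    proof (cases "2 * int n + 1 \<in> set b")
      case False
      have "z \<le> 2 * int n" if "z \<in> set b" for z
      proof -
        have "z \<noteq> 2 * int n + 1" using that False by blast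
        then show ?thesis using sb(2)[OF that] 3 by linarith
      qed
      then have "column n b" using sb by (auto simp: columns_def)
      then show ?thesis using single 3 a by blast
    next
      case True
      then obtain c w where b: "b = c @ [w]" by (cases b rule: rev_cases) auto
      have lt: "sorted_wrt (<) c" "\<And>z. z \<in> set c \<Longrightarrow> z < w" using sb b by (auto simp: sorted_wrt_append)
      have "w < 2 * int n + 2" using sb(2)[of w] b 3 by simp
      moreover have "2 * int n + 1 \<le> w" using True b lt(2)[of "2 * int n + 1"] by auto
      ultimately have w: "w = 2 * int n + 1" by linarith
      have "column n c" using lt sb b w by (fastforce simp: columns_def)
      then show ?thesis using both a b w 3 by simp
    qed
  qed
qed

lemma symplectic_snoc:
  "symplectic (a @ [x]) \<longleftrightarrow> symplectic a \<and> 2 * int (length a) + 1 \<le> x"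
proof -
  have "{1..length (a @ [x])} = insert (Suc (length a)) {1..length a}" by auto
  moreover have "(\<forall>i\<in>{1..length a}. 2 * int i - 1 \<le> (a @ [x]) ! (i - 1)) \<longleftrightarrow> symplectic a"
    by (auto simp: symplectic_def nth_append)
  ultimately show ?thesis by (simp add: symplectic_def) auto
qed

section \<open>Removal entries of an extended column\<close>

lemma removal_entries_Nil: "removal_entries [] = {}"
  by (simp add: removal_entries.simps)

lemma removal_entries_snoc:
  assumes "odd x \<or> x - 1 \<notin> set a"
  shows "removal_entries (a @ [x]) = removal_entries a"
proof (cases a rule: rev_cases)
  case Nil
  then show ?thesis by (simp add: removal_entries.simps)
next
  case (snoc b y)
  then show ?thesis using assms
    by (subst removal_entries.simps) (auto simp: Let_def nth_append)
qed

lemma removal_entries_snoc_pair: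
  assumes "odd x" and "y = x + 1"
  shows "removal_entries (a @ [x, y]) =
    (if x < 2 * int (length a) + 2 - int (card (removal_entries a))
     then removal_entries a \<union> {x, y} else removal_entries a)"
proof -
  have "removal_entries (a @ [x]) = removal_entries a"
    using assms(1) by (intro removal_entries_snoc) auto
  then show ?thesis using assms
    by (subst removal_entries.simps) (auto simp: Let_def nth_append)
qed

section \<open>The reduction as a walk\<close>

text \<open>
  In \<open>reduces n a b p\<close> the column \<open>a\<close> on \<open>n\<close> pairs of letters has reduction \<open>b\<close> and \<open>p\<close> removed
  pairs. The rules do not mention the removal entries, so that they can be read from \<open>a\<close> to \<open>(b, p)\<close>
  as well as backwards.
\<close>
inductive reduces :: "nat \<Rightarrow> int list \<Rightarrow> int list \<Rightarrow> nat \<Rightarrow> bool" where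
  start: "reduces 0 [] [] 0"
| absent: "reduces n a b p \<Longrightarrow> reduces (Suc n) a b p"
| single: "reduces n a b p \<Longrightarrow> x = 2 * int n + 1 \<or> x = 2 * int n + 2 \<Longrightarrow>
    reduces (Suc n) (a @ [x]) (b @ [x]) p"
| kept: "reduces n a b p \<Longrightarrow> length b + p < n \<Longrightarrow>
    reduces (Suc n) (a @ [2 * int n + 1, 2 * int n + 2]) (b @ [2 * int n + 1, 2 * int n + 2]) p"
| removed: "reduces n a b p \<Longrightarrow> length b + p = n \<Longrightarrow>
    reduces (Suc n) (a @ [2 * int n + 1, 2 * int n + 2]) b (Suc p)"

lemma reduces_shape:
  assumes "reduces n a b p"
  shows "column n a" "column n b" "symplectic b" "length b + p \<le> n" "length a = length b + 2 * p"
proof -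
  have "column n a \<and> column n b \<and> symplectic b \<and> length b + p \<le> n \<and> length a = length b + 2 * p"
    using assms
  proof induction
    case start
    show ?case by (simp add: column_Nil symplectic_def)
  next
    case (absent n a b p)
    then show ?case using column_Suc by auto
  next
    case (single n a b p x)
    then show ?case using column_snoc by (auto simp: symplectic_snoc)
  next
    case (kept n a b p)
    then show ?case
      using column_snoc_pair symplectic_snoc[of "b @ [2 * int n + 1]" "2 * int n + 2"]
      by (auto simp: symplectic_snoc)
  next
    case (removed n a b p)
    then show ?case using column_snoc_pair[of a n "length a"] column_Suc by auto
  qed
  then show "column n a" "column n b" "symplectic b" "length b + p \<le> n"
    "length a = length b + 2 * p" by auto
qed

text \<open>
  The test for removing the pair \<open>2n + 1, 2n + 2\<close> compares \<open>2n + 1\<close> with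
  \<open>2 (length b + 2 p) + 2 - 2 p\<close>, that is, it asks for \<open>n \<le> length b + p\<close>. As the reverse inequality
  always holds, this is the equality required by the rule for removed pairs.
\<close>
lemma reduces_sound:
  assumes "reduces n a b p"
  shows "reduction a = b" "removal_entries a \<subseteq> set a" "card (removal_entries a) = 2 * p"
proof -
  have "reduction a = b \<and> removal_entries a \<subseteq> set a \<and> card (removal_entries a) = 2 * p"
    using assms
  proof induction
    case start
    show ?case by (simp add: removal_entries_Nil reduction_def)
  next
    case (absent n a b p)
    then show ?case by simp
  next
    case (single n a b p x)
    note new = column_bound[OF reduces_shape(1)[OF single.hyps(1)]]
    have "removal_entries (a @ [x]) = removal_entries a"
      using single.hyps(2) new by (intro removal_entries_snoc) force
    moreover have "x \<notin> removal_entries a" using single.hyps(2) single.IH new by force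
    ultimately show ?case using single.IH by (auto simp: reduction_def)
  next
    case (kept n a b p)
    note new = column_bound[OF reduces_shape(1)[OF kept.hyps(1)]]
    have "removal_entries (a @ [2 * int n + 1, 2 * int n + 2]) = removal_entries a"
      using removal_entries_snoc_pair[of "2 * int n + 1" "2 * int n + 2" a] kept reduces_shape(5)[OF kept.hyps(1)]
      by simp
    moreover have "2 * int n + 1 \<notin> removal_entries a" "2 * int n + 2 \<notin> removal_entries a"
      using kept.IH new by force+
    ultimately show ?case using kept.IH by (auto simp: reduction_def)
  next
    case (removed n a b p)
    note new = column_bound[OF reduces_shape(1)[OF removed.hyps(1)]]
    have rem: "removal_entries (a @ [2 * int n + 1, 2 * int n + 2]) =
        removal_entries a \<union> {2 * int n + 1, 2 * int n + 2}"
      using removal_entries_snoc_pair[of "2 * int n + 1" "2 * int n + 2" a] removed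
        reduces_shape(5)[OF removed.hyps(1)]
      by simp
    have "2 * int n + 1 \<notin> set a" "2 * int n + 2 \<notin> set a" using new by force+
    moreover from this have "filter (\<lambda>x. x \<notin> removal_entries a \<union> {2 * int n + 1, 2 * int n + 2}) a =
        filter (\<lambda>x. x \<notin> removal_entries a) a"
      by (intro filter_cong) auto
    moreover have "finite (removal_entries a)" using removed.IH finite_subset by blast
    ultimately show ?case
      using removed.IH rem by (auto simp: reduction_def card_insert_if)
  qed
  then show "reduction a = b" "removal_entries a \<subseteq> set a" "card (removal_entries a) = 2 * p"
    by auto
qed

lemma reduces_total:
  assumes "column n a"
  shows "\<exists>b p. reduces n a b p"
  using assms
proof (induction n arbitrary: a)
  case 0
  then show ?case using column_0 start by blast
next
  case (Suc n)
  from Suc.prems show ?case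
  proof (cases rule: column_Suc_cases)
    case absent
    then show ?thesis using Suc.IH reduces.absent by blast
  next
    case (single c x)
    then show ?thesis using Suc.IH reduces.single by blast
  next
    case (both c)
    then obtain d p where r: "reduces n c d p" using Suc.IH by blast
    then have "length d + p < n \<or> length d + p = n" using reduces_shape(4) by fastforce
    then show ?thesis using r both reduces.kept reduces.removed by blast
  qed
qed

section \<open>Inverting the walk\<close>

lemma symplectic_length:
  assumes "column n b" and "symplectic b"
  shows "length b \<le> n"
proof (cases b rule: rev_cases)
  case (snoc c x)
  then have "2 * int (length c) + 1 \<le> x" using assms(2) symplectic_snoc by simp
  moreover have "x \<le> 2 * int n" using column_bound[OF assms(1)] snoc by simp
  ultimately show ?thesis using snoc by simp
qed simp

text \<open>
  Suppose that the last of \<open>n + 1\<close> pairs is absent from \<open>b\<close>. If \<open>length b + p \<le> n\<close>, then \<open>b\<close> and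
  \<open>p\<close> already arise from a column on \<open>n\<close> pairs. Otherwise \<open>length b + p = n + 1\<close>, and a column on
  \<open>n\<close> pairs for \<open>b\<close> and \<open>p - 1\<close> has no slack left, so that a last full pair added to it is removed.
\<close>
lemma reduces_surj:
  assumes "column n b" and "symplectic b" and "length b + p \<le> n"
  shows "\<exists>a. reduces n a b p"
  using assms
proof (induction n arbitrary: b p)
  case 0
  then show ?case using start by auto
next
  case (Suc n)
  from Suc.prems(1) show ?case
  proof (cases rule: column_Suc_cases)
    case absent
    show ?thesis
    proof (cases "length b + p \<le> n")
      case True
      then show ?thesis using Suc.IH absent Suc.prems(2) reduces.absent by blast
    next
      case False
      moreover have "length b \<le> n" using symplectic_length absent Suc.prems(2) by blast
      ultimately obtain q where q: "p = Suc q" "length b + q = n" using Suc.prems(3) that[of "p - 1"]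
        by linarith
      then obtain a where "reduces n a b q" using Suc.IH absent Suc.prems(2) by blast
      then show ?thesis using q reduces.removed by blast
    qed
  next
    case (single c x)
    then obtain a where "reduces n a c p" using Suc.IH[of c p] Suc.prems by (auto simp: symplectic_snoc)
    then show ?thesis using single reduces.single by blast
  next
    case (both c)
    have "symplectic c"
      using Suc.prems(2) both symplectic_snoc[of "c @ [2 * int n + 1]" "2 * int n + 2"]
      by (simp add: symplectic_snoc)
    moreover have room: "length c + p < n" using Suc.prems(3) both by simp
    ultimately obtain a where "reduces n a c p" using Suc.IH[of c p] both by auto
    then show ?thesis using room both reduces.kept by blast
  qed
qed

text \<open>
  The rule that produced \<open>(b, p)\<close> can be read off: the new letters in \<open>b\<close> are larger than all
  others, which separates absent, single and kept pairs, and a removed pair differs from an absent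
  one by \<open>length b + p\<close>.
\<close>
lemma reduces_inj:
  assumes "reduces n a b p" and "reduces n a' b p"
  shows "a = a'"
  using assms
proof (induction arbitrary: a')
  case start
  then show ?case by (auto elim: reduces.cases)
next
  case (absent n a b p)
  note old = column_bound[OF reduces_shape(2)[OF absent.hyps]] reduces_shape(4)[OF absent.hyps]
  from absent.prems show ?case
    by (cases rule: reduces.cases) (use absent.IH old in \<open>force+\<close>)
next
  case (single n a b p x)
  note old = column_bound[OF reduces_shape(2)[OF single.hyps(1)]]
  from single.prems show ?case
  proof (cases rule: reduces.cases)
    case absent
    then show ?thesis using column_bound[OF reduces_shape(2)[OF absent(1)]] single.hyps(2) by force
  next
    case (single c d y)
    then show ?thesis using \<open>\<And>a'. reduces n a' b p \<Longrightarrow> a = a'\<close> by auto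
  next
    case (kept c d)
    then have "b = d @ [2 * int n + 1]" by simp
    then show ?thesis using old by force
  next
    case (removed c q)
    then show ?thesis
      using column_bound[OF reduces_shape(2)[OF removed(3)]] single.hyps(2) by force
  qed
next
  case (kept n a b p)
  from kept.prems show ?case
  proof (cases rule: reduces.cases)
    case absent
    then show ?thesis using column_bound[OF reduces_shape(2)[OF absent(1)]] by force
  next
    case (single c d y)
    then have "d = b @ [2 * int n + 1]" by simp
    then show ?thesis using column_bound[OF reduces_shape(2)[OF single(3)]] by force
  next
    case (kept c)
    then show ?thesis using \<open>\<And>a'. reduces n a' b p \<Longrightarrow> a = a'\<close> by auto
  next
    case (removed c q)
    then show ?thesis using column_bound[OF reduces_shape(2)[OF removed(3)]] by force
  qed
next
  case (removed n a b p)
  note old = column_bound[OF reduces_shape(2)[OF removed.hyps(1)]]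
  from removed.prems show ?case
  proof (cases rule: reduces.cases)
    case absent
    then show ?thesis using reduces_shape(4)[OF absent(1)] removed.hyps(2) by simp
  next
    case (removed c)
    then show ?thesis using \<open>\<And>a'. reduces n a' b p \<Longrightarrow> a = a'\<close> by auto
  qed (use old in force)+
qed

section \<open>The reduction map on columns of a fixed length\<close>

text \<open>
  With \<open>l = t + 2 p\<close>, the bound \<open>t + p \<le> n\<close> from the walk is the bound \<open>t \<le> 2 n - l\<close>.
\<close>
lemma reduction_in_reduced_columns:
  assumes "a \<in> columns n l"
  shows "reduction a \<in> reduced_columns n l"
proof -
  have l: "length a = l" using assms by (simp add: columns_def)
  then obtain b p where r: "reduces n a b p" using assms reduces_total by blast
  note shape = reduces_shape[OF r]
  have "length b \<le> min l (2 * n - l) \<and> even (l - length b)" using shape(4,5) l by auto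
  moreover have "b \<in> symplectic_columns n (length b)"
    using shape by (simp add: symplectic_columns_def)
  ultimately show ?thesis
    using reduces_sound(1)[OF r] unfolding reduced_columns_def by blast
qed

lemma reduction_surj:
  assumes "b \<in> reduced_columns n l" and "l \<le> 2 * n"
  shows "\<exists>a\<in>columns n l. reduction a = b"
proof -
  have b: "column n b" "symplectic b" "length b \<le> l" "length b \<le> 2 * n - l" "even (l - length b)"
    using assms(1) by (auto simp: reduced_columns_def symplectic_columns_def columns_def)
  then obtain p where p: "l - length b = 2 * p" by blast
  then have "length b + p \<le> n" using b assms(2) by linarith
  then obtain a where r: "reduces n a b p" using reduces_surj b by blast
  have "length a = l" using reduces_shape(5)[OF r] p b(3) by linarith
  then show ?thesis using reduces_shape(1)[OF r] reduces_sound(1)[OF r] by blast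
qed

lemma reduction_inj: "inj_on reduction (columns n l)"
proof (rule inj_onI)
  fix a a' assume a: "a \<in> columns n l" "a' \<in> columns n l" and eq: "reduction a = reduction a'"
  have len: "length a = l" "length a' = l" using a by (auto simp: columns_def)
  then obtain b p b' p' where r: "reduces n a b p" "reduces n a' b' p'"
    using a reduces_total[of a n] reduces_total[of a' n] by auto
  have "b = b'" using eq r reduces_sound(1) by blast
  moreover from this have "p = p'" using len r reduces_shape(5) by fastforce
  ultimately show "a = a'" using r reduces_inj by blast
qed

theorem proposition6:
  fixes n l :: nat
  assumes "n \<ge> 1" and "l \<le> 2 * n"
  shows "reduction ` columns n l = reduced_columns n l \<and>
         bij_betw reduction (columns n l) (reduced_columns n l)"
proof -
  have "reduction ` columns n l = reduced_columns n l"
    using reduction_in_reduced_columns reduction_surj[OF _ assms(2)] by blast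
  then show ?thesis using reduction_inj by (simp add: bij_betw_def)
qed

end
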